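(* Let $k$ be an algebraically closed field and $X\subset\mathbb P_k^{n-1}$ a smooth simplicial projective toric variety. Then $X$ is an ideal-theoretic complete intersection if and only if $X$ is the plane monomial curve defined parametrically by $x_1=t_1^2,\ x_2=t_2^2,\ x_3=t_1t_2$.
   Context: $e_1,\ldots,e_m$ is the canonical basis of $\mathbb Z^m$. For distinct nonzero $a_1,\ldots,a_n\in\mathbb N^m$, $I_{\mathcal A}\subset k[x_1,\ldots,x_n]$ is the kernel of $x_i\mapsto t^{a_i}=t_1^{a_{i1}}\cdots t_m^{a_{im}}$. A simplicial projective toric variety is $V(I_{\mathcal A})\subset\mathbb P^{n-1}_k$ where $n>m$, $a_l=de_l$ ($1\le l\le m$) for some $d\in\mathbb Z^+$, and each $a_i$, $i>m$, has coordinate sum $d$. A variety is an ideal-theoretic complete intersection if its defining ideal $I_{\mathcal A}$ is minimally generated by as many elements as its height $n-m$. The variety given parametrically by monomials $x_l=t^{b_l}$ is $V(I_{\{b_l\}})$ (up to permuting coordinates). *)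

theory Defs
  imports "HOL-Library.Poly_Mapping" "HOL-Computational_Algebra.Polynomial"
          "HOL-Combinatorics.Permutations" "HOL-Library.Function_Algebras"
begin

text \<open>Polynomials in variables x_0, x_1, ... (0-based) with coefficients in 'k:
  finitely supported maps from exponent vectors to coefficients.\<close>
type_synonym 'k mpoly = "(nat \<Rightarrow>\<^sub>0 nat) \<Rightarrow>\<^sub>0 'k"

definition polys :: "nat \<Rightarrow> ('k::comm_ring_1) mpoly set" where
  "polys n = {p. \<forall>u \<in> Poly_Mapping.keys p. Poly_Mapping.keys u \<subseteq> {..<n}}"

definition alg_closed_field :: "'k::field itself \<Rightarrow> bool" where
  "alg_closed_field _ \<longleftrightarrow> (\<forall>p :: 'k poly. degree p > 0 \<longrightarrow> (\<exists>z. poly p z = 0))"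

text \<open>Exponent of t of the image of the monomial x^u under x_i \<mapsto> t^{a_i}.\<close>
definition mon_image :: "nat \<Rightarrow> nat \<Rightarrow> (nat \<Rightarrow> nat \<Rightarrow> nat) \<Rightarrow> (nat \<Rightarrow>\<^sub>0 nat) \<Rightarrow> (nat \<Rightarrow> nat)" where
  "mon_image n m a u = (\<lambda>l. if l < m then (\<Sum>i<n. Poly_Mapping.lookup u i * a i l) else 0)"

text \<open>Toric ideal I_A: kernel of k[x_0..x_{n-1}] \<rightarrow> k[t_0..t_{m-1}], x_i \<mapsto> t^{a_i}
  (where a i l is the l-th coordinate of a_i): a polynomial lies in the kernel iff
  for every monomial t^b the coefficients of all monomials mapping to t^b sum to 0.\<close>
definition toric_ideal :: "nat \<Rightarrow> nat \<Rightarrow> (nat \<Rightarrow> nat \<Rightarrow> nat) \<Rightarrow> ('k::comm_ring_1) mpoly set" where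
  "toric_ideal n m a = {f \<in> polys n. \<forall>b.
      (\<Sum>u \<in> {u \<in> Poly_Mapping.keys f. mon_image n m a u = b}. Poly_Mapping.lookup f u) = 0}"

definition eval_mpoly :: "('k::comm_ring_1) mpoly \<Rightarrow> (nat \<Rightarrow> 'k) \<Rightarrow> 'k" where
  "eval_mpoly f x = (\<Sum>u \<in> Poly_Mapping.keys f. Poly_Mapping.lookup f u * (\<Prod>i \<in> Poly_Mapping.keys u. x i ^ Poly_Mapping.lookup u i))"

definition pderiv_eval :: "nat \<Rightarrow> ('k::comm_ring_1) mpoly \<Rightarrow> (nat \<Rightarrow> 'k) \<Rightarrow> 'k" where
  "pderiv_eval j f x = (\<Sum>u \<in> Poly_Mapping.keys f. Poly_Mapping.lookup f u * of_nat (Poly_Mapping.lookup u j) * x j ^ (Poly_Mapping.lookup u j - 1)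
       * (\<Prod>i \<in> Poly_Mapping.keys u - {j}. x i ^ Poly_Mapping.lookup u i))"

definition gradient :: "nat \<Rightarrow> ('k::comm_ring_1) mpoly \<Rightarrow> (nat \<Rightarrow> 'k) \<Rightarrow> (nat \<Rightarrow> 'k)" where
  "gradient n f x = (\<lambda>j. if j < n then pderiv_eval j f x else 0)"

text \<open>Affine cone (minus the origin) over the projective zero set V(I) \<subseteq> P^{n-1}:
  points of k^n (vectors vanishing outside {..<n}) that are nonzero and annihilated by I.\<close>
definition cone :: "nat \<Rightarrow> ('k::comm_ring_1) mpoly set \<Rightarrow> (nat \<Rightarrow> 'k) set" where
  "cone n I = {x. (\<forall>i \<ge> n. x i = 0) \<and> x \<noteq> (\<lambda>_. 0) \<and> (\<forall>f \<in> I. eval_mpoly f x = 0)}"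

definition vscale :: "'k::field \<Rightarrow> (nat \<Rightarrow> 'k) \<Rightarrow> (nat \<Rightarrow> 'k)" where
  "vscale c v = (\<lambda>i. c * v i)"

text \<open>Smoothness of the variety V(I) \<subseteq> P^{n-1} of codimension c (Jacobian criterion,
  in homogeneous coordinates): at every point the Jacobian of I has rank c.\<close>
definition smooth_proj :: "nat \<Rightarrow> nat \<Rightarrow> ('k::field) mpoly set \<Rightarrow> bool" where
  "smooth_proj n c I \<longleftrightarrow>
     (\<forall>x \<in> cone n I. vector_space.dim vscale {gradient n f x | f. f \<in> I} = c)"

definition gen_ideal :: "nat \<Rightarrow> ('k::comm_ring_1) mpoly set \<Rightarrow> 'k mpoly set" where
  "gen_ideal n G = {(\<Sum>g \<in> G. c g * g) | c. \<forall>g \<in> G. c g \<in> polys n}"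

definition min_gen_by :: "nat \<Rightarrow> nat \<Rightarrow> ('k::comm_ring_1) mpoly set \<Rightarrow> bool" where
  "min_gen_by n r I \<longleftrightarrow>
     (\<exists>G. finite G \<and> G \<subseteq> polys n \<and> card G = r \<and> gen_ideal n G = I) \<and>
     \<not> (\<exists>G. finite G \<and> G \<subseteq> polys n \<and> card G < r \<and> gen_ideal n G = I)"

definition simplicial_data :: "nat \<Rightarrow> nat \<Rightarrow> nat \<Rightarrow> (nat \<Rightarrow> nat \<Rightarrow> nat) \<Rightarrow> bool" where
  "simplicial_data n m d a \<longleftrightarrow> n > m \<and> d > 0 \<and>
     (\<forall>l<m. \<forall>j<m. a l j = (if j = l then d else 0)) \<and>
     (\<forall>i. m \<le> i \<and> i < n \<longrightarrow> (\<Sum>l<m. a i l) = d) \<and>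
     (\<forall>i<n. \<exists>l<m. a i l \<noteq> 0) \<and>
     (\<forall>i<n. \<forall>j<n. i \<noteq> j \<longrightarrow> (\<exists>l<m. a i l \<noteq> a j l))"

definition curve_exps :: "nat \<Rightarrow> nat \<Rightarrow> nat" where
  "curve_exps i l = (if i = 0 then (if l = 0 then 2 else 0)
                     else if i = 1 then (if l = 1 then 2 else 0)
                     else if i = 2 then 1 else 0)"

end

theory Submission
  imports Defs
begin

text \<open>
  Call a monomial isolated if no other monomial has the same image under \<open>x\<^sub>i \<mapsto> t\<^bsup>a\<^sub>i\<^esup>\<close>, and critical
  if it is not isolated but all its proper divisors are. Taking the coefficient of a critical
  monomial is a functional on \<open>I\<close> that kills \<open>\<mm>I\<close>, and critical monomials of different degrees give
  independent functionals; hence \<open>I\<close> needs at least as many generators as there are degrees of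
  critical monomials.

  At the \<open>i\<close>-th coordinate vertex the Jacobian only sees the coefficients of the monomials
  \<open>x\<^sub>i\<^sup>k x\<^sub>j\<close>, and smoothness provides \<open>n - m\<close> indices \<open>j\<close> for which some \<open>x\<^sub>i\<^sup>k x\<^sub>j\<close> is not isolated. For the
  least such \<open>k\<close> these monomials are critical, with distinct degrees. If \<open>n - m\<close> generators suffice,
  all vertices must therefore give the same degrees. A common degree \<open>\<beta>\<close> of total degree \<open>(k + 1) d\<close>
  satisfies \<open>\<beta>\<^sub>i \<ge> k d\<close> for all \<open>i\<close>, so that \<open>m k \<le> k + 1\<close>. This forces \<open>m = 2\<close>, \<open>k = 1\<close>, \<open>\<beta> = (d, d)\<close>,
  whence \<open>j\<close> is unique, \<open>n = 3\<close>, and a second monomial of degree \<open>\<beta>\<close> exists only if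
  \<open>a\<^sub>3 = (d/2, d/2)\<close>. Conversely, for \<open>n = 3\<close> the ideal is principal by division by a binomial that is
  monic in \<open>x\<^sub>3\<close>.
\<close>

abbreviation keys :: "('a \<Rightarrow>\<^sub>0 'b::zero) \<Rightarrow> 'a set" where
  "keys \<equiv> Poly_Mapping.keys"

abbreviation lookup :: "('a \<Rightarrow>\<^sub>0 'b::zero) \<Rightarrow> 'a \<Rightarrow> 'b" where
  "lookup \<equiv> Poly_Mapping.lookup"

abbreviation single :: "'a \<Rightarrow> 'b \<Rightarrow> ('a \<Rightarrow>\<^sub>0 'b::zero)" where
  "single \<equiv> Poly_Mapping.single"

section \<open>Polynomials and toric ideals\<close>

lemma poly_mapping_eq_sum_single:
  "p = (\<Sum>u\<in>keys p. single u (lookup p u))"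
proof (rule poly_mapping_eqI)
  fix k
  have "lookup (\<Sum>u\<in>keys p. single u (lookup p u)) k
      = (\<Sum>u\<in>keys p. if u = k then lookup p u else 0)"
    by (simp add: lookup_sum lookup_single when_def)
  also have "\<dots> = lookup p k"
    by (simp add: in_keys_iff)
  finally show "lookup p k = lookup (\<Sum>u\<in>keys p. single u (lookup p u)) k" by simp
qed

lemma keys_plus_nat: "keys (u + v :: 'a \<Rightarrow>\<^sub>0 nat) = keys u \<union> keys v"
  by (auto simp: in_keys_iff lookup_add)

lemma polys_add: "p \<in> polys n \<Longrightarrow> q \<in> polys n \<Longrightarrow> p + q \<in> polys n"
  using Poly_Mapping.keys_add[of p q] by (auto simp: polys_def)

lemma polys_uminus: "p \<in> polys n \<Longrightarrow> - p \<in> polys n"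
  by (auto simp: polys_def in_keys_iff)

lemma polys_diff: "p \<in> polys n \<Longrightarrow> q \<in> polys n \<Longrightarrow> p - q \<in> polys n"
  using polys_add[of p n "- q"] polys_uminus[of q n] by simp

lemma polys_zero: "0 \<in> polys n"
  by (simp add: polys_def)

lemma polys_single: "keys u \<subseteq> {..<n} \<Longrightarrow> single u c \<in> polys n"
  by (auto simp: polys_def split: if_splits)

lemma mon_image_plus:
  "mon_image n m a (u + v) = (\<lambda>l. mon_image n m a u l + mon_image n m a v l)"
  by (auto simp: mon_image_def fun_eq_iff lookup_add algebra_simps sum.distrib)

lemma mon_image_single:
  assumes "i < n"
  shows "mon_image n m a (single i k) = (\<lambda>l. if l < m then k * a i l else 0)"
proof -
  have "(\<Sum>j<n. lookup (single i k) j * a j l) = k * a i l" for l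
  proof -
    have "(\<Sum>j<n. lookup (single i k) j * a j l) = (\<Sum>j<n. if i = j then k * a j l else 0)"
      by (intro sum.cong) (auto simp: lookup_single when_def)
    then show ?thesis using assms by simp
  qed
  then show ?thesis by (simp add: mon_image_def fun_eq_iff)
qed

lemma fibre_sum_eq:
  assumes "finite A" "keys f \<subseteq> A"
  shows "(\<Sum>u\<in>{u\<in>keys f. P u}. lookup f u) = (\<Sum>u\<in>A. if P u then lookup f u else 0)"
proof -
  have "(\<Sum>u\<in>{u\<in>keys f. P u}. lookup f u) = (\<Sum>u\<in>keys f. if P u then lookup f u else 0)"
    by (rule sum.inter_filter) simp
  also have "\<dots> = (\<Sum>u\<in>A. if P u then lookup f u else 0)"
    using assms by (intro sum.mono_neutral_left) (auto simp: in_keys_iff)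
  finally show ?thesis .
qed

lemma toric_ideal_add:
  assumes "f \<in> toric_ideal n m a" "g \<in> toric_ideal n m a"
  shows "f + g \<in> toric_ideal n m a"
proof -
  let ?A = "keys f \<union> keys g"
  let ?P = "\<lambda>b u. mon_image n m a u = b"
  have fin: "finite ?A" by simp
  have "(\<Sum>u\<in>{u\<in>keys (f + g). ?P b u}. lookup (f + g) u) = 0" for b
  proof -
    have "(\<Sum>u\<in>{u\<in>keys (f + g). ?P b u}. lookup (f + g) u)
       = (\<Sum>u\<in>?A. if ?P b u then lookup (f + g) u else 0)"
      by (rule fibre_sum_eq[OF fin]) (rule Poly_Mapping.keys_add)
    also have "\<dots> = (\<Sum>u\<in>?A. if ?P b u then lookup f u else 0)
                  + (\<Sum>u\<in>?A. if ?P b u then lookup g u else 0)"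
      by (subst sum.distrib[symmetric]) (auto intro!: sum.cong simp: lookup_add)
    also have "\<dots> = (\<Sum>u\<in>{u\<in>keys f. ?P b u}. lookup f u)
                   + (\<Sum>u\<in>{u\<in>keys g. ?P b u}. lookup g u)"
      using fibre_sum_eq[OF fin, of f "?P b"] fibre_sum_eq[OF fin, of g "?P b"] by simp
    finally show ?thesis using assms by (simp add: toric_ideal_def)
  qed
  then show ?thesis using assms by (simp add: toric_ideal_def polys_add)
qed

lemma toric_ideal_uminus: "f \<in> toric_ideal n m a \<Longrightarrow> - f \<in> toric_ideal n m a"
  by (simp add: toric_ideal_def polys_uminus sum_negf in_keys_iff)

lemma toric_ideal_diff:
  "f \<in> toric_ideal n m a \<Longrightarrow> g \<in> toric_ideal n m a \<Longrightarrow> f - g \<in> toric_ideal n m a"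
  using toric_ideal_add[of f n m a "- g"] toric_ideal_uminus[of g n m a] by simp

lemma toric_ideal_zero: "0 \<in> toric_ideal n m a"
  by (simp add: toric_ideal_def polys_zero)

lemma toric_ideal_binomial:
  assumes "keys u \<subseteq> {..<n}" "keys v \<subseteq> {..<n}" "mon_image n m a u = mon_image n m a v"
  shows "single u c - single v c \<in> toric_ideal n m a"
proof (cases "u = v")
  case True
  then show ?thesis by (simp add: toric_ideal_zero)
next
  case False
  let ?f = "single u c - single v c"
  have k: "keys ?f \<subseteq> {u, v}"
    by (auto simp: in_keys_iff lookup_minus lookup_single when_def split: if_splits)
  have "(\<Sum>w\<in>{w\<in>keys ?f. mon_image n m a w = b}. lookup ?f w) = 0" for b
    using fibre_sum_eq[OF _ k, of "\<lambda>w. mon_image n m a w = b"] False assms(3)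
    by (simp add: lookup_minus lookup_single)
  then show ?thesis using assms by (simp add: toric_ideal_def polys_diff polys_single)
qed

text \<open>Membership depends only on how the map to exponents partitions the monomials into
  fibres; an exponent \<open>b\<close> that is not attained imposes the empty condition. This allows
  the \<open>a i\<close> to be rescaled.\<close>

lemma toric_ideal_cong:
  assumes "\<And>u v. mon_image n m a u = mon_image n m a v
             \<longleftrightarrow> mon_image n m a' u = mon_image n m a' v"
  shows "toric_ideal n m a = toric_ideal n m a'"
proof -
  have sub: "toric_ideal n m a \<subseteq> (toric_ideal n m a' :: 'a::comm_ring_1 mpoly set)"
    if eq: "\<And>u v. mon_image n m a u = mon_image n m a v
              \<longleftrightarrow> mon_image n m a' u = mon_image n m a' v" for a a'
  proof
    fix f :: "'a mpoly"
    assume f: "f \<in> toric_ideal n m a"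
    have "(\<Sum>u\<in>{u\<in>keys f. mon_image n m a' u = b}. lookup f u) = 0" for b
    proof (cases "\<exists>v. mon_image n m a' v = b")
      case True
      then obtain v where "b = mon_image n m a' v" by auto
      then have "{u\<in>keys f. mon_image n m a' u = b}
               = {u\<in>keys f. mon_image n m a u = mon_image n m a v}"
        using eq by blast
      then show ?thesis using f by (simp add: toric_ideal_def)
    qed simp
    then show "f \<in> toric_ideal n m a'" using f by (simp add: toric_ideal_def)
  qed
  show ?thesis using sub[of a a'] sub[of a' a] assms by blast
qed

section \<open>Isolated and critical monomials\<close>

definition isolated :: "nat \<Rightarrow> nat \<Rightarrow> (nat \<Rightarrow> nat \<Rightarrow> nat) \<Rightarrow> (nat \<Rightarrow>\<^sub>0 nat) \<Rightarrow> bool" where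
  "isolated n m a w \<longleftrightarrow>
     (\<forall>v. keys v \<subseteq> {..<n} \<longrightarrow> mon_image n m a v = mon_image n m a w \<longrightarrow> v = w)"

text \<open>Within the \<open>n\<close> variables these are the minimal generators of the monomial
  ideal spanned by the non-isolated monomials.\<close>

definition critical :: "nat \<Rightarrow> nat \<Rightarrow> (nat \<Rightarrow> nat \<Rightarrow> nat) \<Rightarrow> (nat \<Rightarrow>\<^sub>0 nat) \<Rightarrow> bool" where
  "critical n m a w \<longleftrightarrow> keys w \<subseteq> {..<n} \<and> \<not> isolated n m a w \<and>
     (\<forall>s v. w = s + v \<longrightarrow> s \<noteq> 0 \<longrightarrow> isolated n m a v)"

lemma lookup_isolated_eq_0:
  assumes "f \<in> toric_ideal n m a" "isolated n m a w"
  shows "lookup f w = 0"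
proof (rule ccontr)
  assume "lookup f w \<noteq> 0"
  then have "w \<in> keys f" by (simp add: in_keys_iff)
  then have "{u \<in> keys f. mon_image n m a u = mon_image n m a w} = {w}"
    using assms by (auto simp: toric_ideal_def polys_def isolated_def)
  moreover have "(\<Sum>u\<in>{u \<in> keys f. mon_image n m a u = mon_image n m a w}. lookup f u) = 0"
    using assms(1) by (simp add: toric_ideal_def)
  ultimately show False using \<open>lookup f w \<noteq> 0\<close> by simp
qed

text \<open>A nonconstant term of \<open>c\<close> could reach \<open>w\<close> only from a proper
  divisor of \<open>w\<close> in the support of \<open>f\<close>. Such a divisor is isolated, so its
  coefficient in \<open>f\<close> is zero, and only the constant term of \<open>c\<close>
  contributes.\<close>

lemma lookup_mult_critical:
  fixes c f :: "'k::comm_ring_1 mpoly"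
  assumes f: "f \<in> toric_ideal n m a" and w: "critical n m a w"
  shows "lookup (c * f) w = lookup c 0 * lookup f w"
proof -
  have mono: "lookup (single u r * f) w = (if u = 0 then r * lookup f w else 0)" for u r
  proof (cases "u = 0")
    case True
    then show ?thesis
      by (simp add: mult_map_scale_conv_mult[symmetric] Poly_Mapping.map.rep_eq when_def)
  next
    case False
    have "w \<notin> keys (single u r * f)"
    proof
      assume "w \<in> keys (single u r * f)"
      then obtain v where v: "w = u + v" "v \<in> keys f"
        using keys_mult[of "single u r" f] by (auto split: if_splits)
      then have "isolated n m a v" using w False by (auto simp: critical_def)
      then show False using lookup_isolated_eq_0[OF f] v by (simp add: in_keys_iff)
    qed
    then show ?thesis using False by (simp add: in_keys_iff)
  qed
  have "lookup (c * f) w = lookup (\<Sum>u\<in>keys c. single u (lookup c u) * f) w"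
    by (subst poly_mapping_eq_sum_single[of c]) (simp only: sum_distrib_right)
  also have "\<dots> = (\<Sum>u\<in>keys c. if u = 0 then lookup c u * lookup f w else 0)"
    by (simp add: lookup_sum mono)
  also have "\<dots> = lookup c 0 * lookup f w"
    by (simp add: in_keys_iff)
  finally show ?thesis .
qed

text \<open>Gaussian elimination, one equation \<open>g\<close> at a time, with the unknowns indexed
  by \<open>T\<close>.\<close>

lemma underdetermined_system:
  fixes v :: "'t \<Rightarrow> 'g \<Rightarrow> 'k::field"
  assumes "finite G" "finite T" "card G < card T"
  shows "\<exists>\<mu>. (\<exists>t\<in>T. \<mu> t \<noteq> 0) \<and> (\<forall>g\<in>G. (\<Sum>t\<in>T. \<mu> t * v t g) = 0)"
  using assms
proof (induction G arbitrary: T v rule: finite_induct)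
  case empty
  then have "T \<noteq> {}" by auto
  then show ?case by (intro exI[of _ "\<lambda>_. 1"]) auto
next
  case (insert g G)
  show ?case
  proof (cases "\<forall>t\<in>T. v t g = 0")
    case True
    obtain \<mu> where "\<exists>t\<in>T. \<mu> t \<noteq> 0" "\<forall>g\<in>G. (\<Sum>t\<in>T. \<mu> t * v t g) = 0"
      using insert.IH[of T v] insert.prems insert.hyps by auto
    then show ?thesis using True by (intro exI[of _ \<mu>]) auto
  next
    case False
    then obtain s where s: "s \<in> T" "v s g \<noteq> 0" by blast
    \<comment> \<open>The unknown \<open>s\<close> is the pivot of equation \<open>g\<close>;
      \<open>?v\<close> is the system after eliminating it, so that
      \<open>?v t g = 0\<close>.\<close>
    let ?T = "T - {s}"
    let ?v = "\<lambda>t h. v t h - v t g / v s g * v s h"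
    have "card G < card ?T" using insert s by (simp add: card_Diff_singleton)
    then obtain \<mu> where \<mu>: "\<exists>t\<in>?T. \<mu> t \<noteq> 0" "\<forall>h\<in>G. (\<Sum>t\<in>?T. \<mu> t * ?v t h) = 0"
      using insert.IH[of ?T ?v] insert.prems by auto
    \<comment> \<open>The eliminated unknown is recovered by solving equation \<open>g\<close> for
      it.\<close>
    define \<nu> where "\<nu> = \<mu>(s := - (\<Sum>t\<in>?T. \<mu> t * v t g / v s g))"
    have eq: "(\<Sum>t\<in>T. \<nu> t * v t h) = (\<Sum>t\<in>?T. \<mu> t * ?v t h)" for h
    proof -
      have "(\<Sum>t\<in>T. \<nu> t * v t h) = \<nu> s * v s h + (\<Sum>t\<in>?T. \<nu> t * v t h)"
        using s insert.prems by (simp add: sum.remove)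
      also have "(\<Sum>t\<in>?T. \<nu> t * v t h) = (\<Sum>t\<in>?T. \<mu> t * v t h)"
        by (intro sum.cong) (auto simp: \<nu>_def)
      also have "\<nu> s * v s h = (\<Sum>t\<in>?T. - (\<mu> t * (v t g / v s g * v s h)))"
        by (simp add: \<nu>_def sum_distrib_right sum_negf mult.assoc)
      finally show ?thesis
        by (simp add: sum.distrib[symmetric] algebra_simps)
    qed
    have "(\<Sum>t\<in>T. \<nu> t * v t h) = 0" if "h \<in> insert g G" for h
      using that \<mu>(2) s by (auto simp: eq)
    moreover have "\<exists>t\<in>T. \<nu> t \<noteq> 0" using \<mu>(1) by (auto simp: \<nu>_def)
    ultimately show ?thesis by blast
  qed
qed

lemma gen_ideal_superset:
  assumes "finite G" "g \<in> G"
  shows "g \<in> gen_ideal n G"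
proof -
  have "(\<Sum>h\<in>G. (if h = g then 1 else 0) * h) = (\<Sum>h\<in>G. if h = g then h else 0)"
    by (intro sum.cong) auto
  also have "\<dots> = g" using assms by simp
  finally have "g = (\<Sum>h\<in>G. (if h = g then 1 else 0) * h)" by simp
  moreover have "\<forall>h\<in>G. (if h = g then 1 else 0) \<in> polys n"
    by (auto simp: polys_def)
  ultimately show ?thesis by (force simp: gen_ideal_def)
qed

text \<open>With fewer generators than elements of \<open>W\<close>, some nontrivial combination of
  the coefficient functionals kills every generator, hence the whole ideal. A binomial
  \<open>w - v\<close> with \<open>\<mu> w\<close> nonzero contradicts this.\<close>

lemma card_critical_le_generators:
  fixes G :: "'k::field mpoly set"
  assumes G: "finite G" "gen_ideal n G = toric_ideal n m a"
    and W: "finite W" "\<And>w. w \<in> W \<Longrightarrow> critical n m a w" "inj_on (mon_image n m a) W"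
  shows "card W \<le> card G"
proof (rule ccontr)
  assume "\<not> card W \<le> card G"
  then obtain \<mu> where nz: "\<exists>w\<in>W. \<mu> w \<noteq> 0"
    and rel: "\<And>g. g \<in> G \<Longrightarrow> (\<Sum>w\<in>W. \<mu> w * lookup g w) = 0"
    using underdetermined_system[OF G(1) W(1), of "\<lambda>w g. lookup g w"] by auto
  have vanish: "(\<Sum>w\<in>W. \<mu> w * lookup f w) = 0" if "f \<in> toric_ideal n m a" for f
  proof -
    from that G(2) obtain c where f: "f = (\<Sum>g\<in>G. c g * g)"
      by (auto simp: gen_ideal_def)
    have "lookup f w = (\<Sum>g\<in>G. lookup (c g) 0 * lookup g w)" if "w \<in> W" for w
      unfolding f lookup_sum using gen_ideal_superset[OF G(1)] G(2) W(2)[OF that]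
      by (intro sum.cong) (auto intro!: lookup_mult_critical)
    then have "(\<Sum>w\<in>W. \<mu> w * lookup f w)
             = (\<Sum>w\<in>W. \<Sum>g\<in>G. lookup (c g) 0 * (\<mu> w * lookup g w))"
      by (simp add: sum_distrib_left algebra_simps)
    also have "\<dots> = (\<Sum>g\<in>G. lookup (c g) 0 * (\<Sum>w\<in>W. \<mu> w * lookup g w))"
      by (subst sum.swap) (simp add: sum_distrib_left)
    finally show ?thesis using rel by simp
  qed
  from nz obtain w where w: "w \<in> W" "\<mu> w \<noteq> 0" by blast
  have "\<not> isolated n m a w" using W(2)[OF w(1)] by (simp add: critical_def)
  then obtain v where v: "keys v \<subseteq> {..<n}" "mon_image n m a v = mon_image n m a w" "v \<noteq> w"
    by (auto simp: isolated_def)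
  let ?f = "single w 1 - single v 1 :: 'k mpoly"
  have "?f \<in> toric_ideal n m a"
    using w v W(2) by (intro toric_ideal_binomial) (auto simp: critical_def)
  then have "0 = (\<Sum>u\<in>W. \<mu> u * lookup ?f u)" using vanish by simp
  also have "\<dots> = (\<Sum>u\<in>W. if u = w then \<mu> u else 0)"
  proof (intro sum.cong refl)
    fix u assume u: "u \<in> W"
    \<comment> \<open>As \<open>v\<close> differs from \<open>w\<close> but has the same degree,
      injectivity of the degree on \<open>W\<close> keeps \<open>v\<close> out of
      \<open>W\<close>.\<close>
    have "u \<noteq> v" using v inj_onD[OF W(3) _ u w(1)] by auto
    then show "\<mu> u * lookup ?f u = (if u = w then \<mu> u else 0)"
      using v(3) by (auto simp: lookup_minus lookup_single when_def)
  qed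
  also have "\<dots> = \<mu> w" using w W(1) by simp
  finally show False using w by simp
qed

section \<open>Smoothness at the coordinate vertices\<close>

lemma simplicial_sum:
  assumes "simplicial_data n m d a" "i < n"
  shows "(\<Sum>l<m. a i l) = d"
proof (cases "i < m")
  case True
  then have "(\<Sum>l<m. a i l) = (\<Sum>l<m. if l = i then d else 0)"
    using assms by (intro sum.cong) (auto simp: simplicial_data_def)
  then show ?thesis using True by simp
qed (use assms in \<open>simp add: simplicial_data_def\<close>)

lemma simplicial_inj:
  assumes "simplicial_data n m d a" "i < n" "j < n" "\<And>l. l < m \<Longrightarrow> a i l = a j l"
  shows "i = j"
  using assms unfolding simplicial_data_def by blast

lemma sum_mon_image:
  assumes "simplicial_data n m d a"
  shows "(\<Sum>l<m. mon_image n m a v l) = d * (\<Sum>i<n. lookup v i)"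
proof -
  have "(\<Sum>l<m. mon_image n m a v l) = (\<Sum>i<n. \<Sum>l<m. lookup v i * a i l)"
    by (simp add: mon_image_def) (rule sum.swap)
  also have "\<dots> = (\<Sum>i<n. lookup v i * d)"
    using simplicial_sum[OF assms] by (simp add: sum_distrib_left[symmetric])
  finally show ?thesis by (simp add: sum_distrib_left mult.commute)
qed

text \<open>For \<open>m = 1\<close> all \<open>a i\<close> equal \<open>d\<close>, although at
  least two distinct ones exist.\<close>

lemma simplicial_m_ge_2:
  assumes "simplicial_data n m d a"
  shows "2 \<le> m"
proof (rule ccontr)
  have sd: "m < n" "\<exists>l<m. a 0 l \<noteq> 0" using assms by (auto simp: simplicial_data_def)
  assume "\<not> 2 \<le> m"
  with sd have m: "m = 1" by auto
  have "a 0 0 = d" "a 1 0 = d"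
    using simplicial_sum[OF assms, of 0] simplicial_sum[OF assms, of 1] sd m by auto
  then show False using simplicial_inj[OF assms, of 0 1] sd m by auto
qed

text \<open>For \<open>t\<close> other than \<open>i\<close>, the vector \<open>a t\<close> has a
  positive coordinate away from \<open>i\<close>: otherwise coordinate sum \<open>d\<close> would
  make it equal to \<open>a i\<close>. Hence no such variable occurs in a monomial with the degree
  of a power of the \<open>i\<close>-th one.\<close>

lemma isolated_vertex_power:
  assumes sd: "simplicial_data n m d a" and i: "i < m"
  shows "isolated n m a (single i k)"
  unfolding isolated_def
proof (intro allI impI)
  fix v assume v: "keys v \<subseteq> {..<n}" and img: "mon_image n m a v = mon_image n m a (single i k)"
  have mn: "m < n" and d: "d > 0" and ai: "\<And>l. l < m \<Longrightarrow> a i l = (if l = i then d else 0)"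
    using sd i by (auto simp: simplicial_data_def)
  have img': "(\<Sum>s<n. lookup v s * a s l) = k * a i l" if "l < m" for l
    using fun_cong[OF img, of l] that i mn by (simp add: mon_image_single) (simp add: mon_image_def)
  have 0: "lookup v t = 0" if t: "t < n" "t \<noteq> i" for t
  proof -
    have "\<exists>l<m. l \<noteq> i \<and> a t l \<noteq> 0"
    proof (rule ccontr)
      assume "\<not> ?thesis"
      then have z: "a t l = 0" if "l < m" "l \<noteq> i" for l using that by auto
      have "(\<Sum>l<m. a t l) = (\<Sum>l<m. if l = i then a t l else 0)"
        by (intro sum.cong) (auto simp: z)
      then have "a t i = d" using simplicial_sum[OF sd t(1)] i by simp
      then have "a t l = a i l" if "l < m" for l using that z ai by simp
      then show False using simplicial_inj[OF sd t(1), of i] i mn t by auto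
    qed
    then obtain l where l: "l < m" "l \<noteq> i" "a t l \<noteq> 0" by blast
    then have "(\<Sum>s<n. lookup v s * a s l) = 0" using img' ai by simp
    then have "lookup v t * a t l = 0" using t by simp
    then show ?thesis using l by simp
  qed
  have "(\<Sum>s<n. lookup v s * a s i) = (\<Sum>s<n. if s = i then lookup v s * a s i else 0)"
    using 0 by (intro sum.cong) auto
  then have "lookup v i * d = k * d" using img'[OF i] i mn ai by auto
  then have vi: "lookup v i = k" using d by simp
  have "lookup v t = 0" if "t \<noteq> i" for t
  proof (cases "t < n")
    case False
    then have "t \<notin> keys v" using v by auto
    then show ?thesis by (simp add: in_keys_iff)
  qed (use 0 that in simp)
  then show "v = single i k"
    using vi by (intro poly_mapping_eqI) (auto simp: lookup_single when_def)
qed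

text \<open>The indices \<open>j\<close> for which \<open>dx\<^sub>j\<close> occurs in a conormal vector of the cone over the variety
  at the \<open>i\<close>-th vertex.\<close>

definition conormal_indices :: "nat \<Rightarrow> nat \<Rightarrow> (nat \<Rightarrow> nat \<Rightarrow> nat) \<Rightarrow> nat \<Rightarrow> nat set" where
  "conormal_indices n m a i =
     {j. j < n \<and> j \<noteq> i \<and> (\<exists>k. \<not> isolated n m a (single i k + single j 1))}"

definition vertex :: "nat \<Rightarrow> nat \<Rightarrow> 'k::field" where
  "vertex i = (\<lambda>l. if l = i then 1 else 0)"

lemma finite_conormal_indices: "finite (conormal_indices n m a i)"
  by (rule finite_subset[of _ "{..<n}"]) (auto simp: conormal_indices_def)

text \<open>Only pure powers of the \<open>i\<close>-th variable are nonzero at the vertex, and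
  these have coefficient zero in the ideal because they are isolated.\<close>

lemma vertex_in_cone:
  assumes sd: "simplicial_data n m d a" and i: "i < m"
  shows "(vertex i :: nat \<Rightarrow> 'k::field) \<in> cone n (toric_ideal n m a)"
proof -
  have "i < n" using sd i by (auto simp: simplicial_data_def)
  moreover have "(vertex i :: nat \<Rightarrow> 'k) \<noteq> (\<lambda>_. 0)"
    by (auto simp: vertex_def fun_eq_iff)
  moreover have "eval_mpoly f (vertex i) = 0" if f: "f \<in> toric_ideal n m a" for f :: "'k mpoly"
    unfolding eval_mpoly_def
  proof (intro sum.neutral ballI)
    fix u assume u: "u \<in> keys f"
    show "lookup f u * (\<Prod>l\<in>keys u. vertex i l ^ lookup u l) = 0"
    proof (cases "keys u \<subseteq> {i}")
      case True
      then have "u = single i (lookup u i)"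
        by (intro poly_mapping_eqI) (auto simp: lookup_single when_def in_keys_iff)
      then have "isolated n m a u" using isolated_vertex_power[OF sd i] by metis
      then show ?thesis using lookup_isolated_eq_0[OF f] by simp
    next
      case False
      then obtain l where "l \<in> keys u" "l \<noteq> i" by blast
      then have "\<exists>l\<in>keys u. vertex i l ^ lookup u l = (0::'k)"
        by (auto simp: vertex_def in_keys_iff)
      then show ?thesis by (simp add: prod_zero)
    qed
  qed
  ultimately show ?thesis by (auto simp: cone_def vertex_def)
qed

text \<open>For \<open>j\<close> other than \<open>i\<close>, the derivative at the vertex sees only
  monomials that are linear in the \<open>j\<close>-th variable and otherwise powers of the
  \<open>i\<close>-th; for \<open>j = i\<close> it sees only pure powers. All of these are isolated
  here. Since only vanishing is claimed, the characteristic is irrelevant.\<close>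

lemma gradient_vertex_eq_0:
  fixes f :: "'k::field mpoly"
  assumes sd: "simplicial_data n m d a" and i: "i < m"
    and f: "f \<in> toric_ideal n m a" and j: "j \<notin> conormal_indices n m a i"
  shows "gradient n f (vertex i) j = 0"
proof (cases "j < n")
  case jn: True
  have "lookup f u * of_nat (lookup u j) * vertex i j ^ (lookup u j - 1)
       * (\<Prod>l \<in> keys u - {j}. vertex i l ^ lookup u l) = 0" for u
  proof (cases "keys u \<subseteq> {i, j}")
    case False
    then obtain l where "l \<in> keys u - {j}" "l \<noteq> i" by blast
    then have "\<exists>l\<in>keys u - {j}. vertex i l ^ lookup u l = (0::'k)"
      by (auto simp: vertex_def in_keys_iff)
    then show ?thesis by (simp add: prod_zero)
  next
    case True
    show ?thesis
    proof (cases "j = i")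
      case ji: True
      have "u = single i (lookup u i)"
        using True ji by (intro poly_mapping_eqI) (auto simp: lookup_single when_def in_keys_iff)
      then have "isolated n m a u" using isolated_vertex_power[OF sd i] by metis
      then show ?thesis using lookup_isolated_eq_0[OF f] by simp
    next
      case ji: False
      \<comment> \<open>Exponent 0 is killed by the factor from differentiation, exponent at least 2
        by a remaining power of the vanishing coordinate \<open>j\<close>.\<close>
      consider "lookup u j = 0" | "lookup u j = 1" | "lookup u j - 1 > 0" by linarith
      then show ?thesis
      proof cases
        case 2
        have "u = single i (lookup u i) + single j 1"
          using True ji 2
          by (intro poly_mapping_eqI) (auto simp: lookup_single lookup_add when_def in_keys_iff)
        then have "isolated n m a u"
          using j jn ji by (metis (mono_tags, lifting) conormal_indices_def mem_Collect_eq)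
        then show ?thesis using lookup_isolated_eq_0[OF f] by simp
      qed (use ji in \<open>simp_all add: vertex_def\<close>)
    qed
  qed
  then have "pderiv_eval j f (vertex i) = 0"
    unfolding pderiv_eval_def by (intro sum.neutral ballI)
  then show ?thesis by (simp add: gradient_def)
qed (simp add: gradient_def)

lemma vector_space_vscale: "vector_space (vscale :: 'k::field \<Rightarrow> _)"
  by unfold_locales (auto simp: vscale_def fun_eq_iff algebra_simps)

lemma sum_apply: "(\<Sum>x\<in>A. f x) l = (\<Sum>x\<in>A. f x l)"
  by (induction A rule: infinite_finite_induct) auto

lemma dim_le_card_support:
  fixes V :: "(nat \<Rightarrow> 'k::field) set"
  assumes "finite J" "\<And>v j. v \<in> V \<Longrightarrow> j \<notin> J \<Longrightarrow> v j = 0"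
  shows "vector_space.dim vscale V \<le> card J"
proof -
  interpret vector_space "vscale :: 'k \<Rightarrow> (nat \<Rightarrow> 'k) \<Rightarrow> (nat \<Rightarrow> 'k)"
    by (rule vector_space_vscale)
  have "v \<in> span (vertex ` J)" if v: "v \<in> V" for v
  proof -
    have "v = (\<Sum>j\<in>J. vscale (v j) (vertex j))"
    proof
      fix l
      have "(\<Sum>j\<in>J. vscale (v j) (vertex j)) l = (\<Sum>j\<in>J. if l = j then v j else 0)"
        by (simp add: sum_apply) (auto intro!: sum.cong simp: vscale_def vertex_def)
      also have "\<dots> = v l" using assms v by simp
      finally show "v l = (\<Sum>j\<in>J. vscale (v j) (vertex j)) l" by simp
    qed
    moreover have "\<dots> \<in> span (vertex ` J)"
      by (intro span_sum span_scale span_base) auto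
    ultimately show ?thesis by simp
  qed
  then have "dim V \<le> card (vertex ` J :: (nat \<Rightarrow> 'k) set)"
    using assms(1) by (intro dim_le_card) auto
  also have "\<dots> \<le> card J" using assms(1) by (rule card_image_le)
  finally show ?thesis .
qed

text \<open>This is the form in which smoothness enters: the Jacobian has rank \<open>c\<close> at
  the vertex, while all its rows are supported on the conormal indices.\<close>

lemma card_conormal_indices_ge:
  assumes sd: "simplicial_data n m d a" and i: "i < m"
    and smooth: "smooth_proj n c (toric_ideal n m a :: 'k::field mpoly set)"
  shows "c \<le> card (conormal_indices n m a i)"
proof -
  let ?V = "{gradient n f (vertex i) | f. f \<in> (toric_ideal n m a :: 'k mpoly set)}"
  have "c = vector_space.dim vscale ?V"
    by (rule sym, rule bspec[OF smooth[unfolded smooth_proj_def]]) (rule vertex_in_cone[OF sd i])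
  also have "\<dots> \<le> card (conormal_indices n m a i)"
    using gradient_vertex_eq_0[OF sd i]
    by (intro dim_le_card_support finite_conormal_indices) auto
  finally show ?thesis .
qed

section \<open>Critical monomials at the coordinate vertices\<close>

definition vertex_exp :: "nat \<Rightarrow> nat \<Rightarrow> (nat \<Rightarrow> nat \<Rightarrow> nat) \<Rightarrow> nat \<Rightarrow> nat \<Rightarrow> nat" where
  "vertex_exp n m a i j = (LEAST k. \<not> isolated n m a (single i k + single j 1))"

definition vertex_mon :: "nat \<Rightarrow> nat \<Rightarrow> (nat \<Rightarrow> nat \<Rightarrow> nat) \<Rightarrow> nat \<Rightarrow> nat \<Rightarrow> (nat \<Rightarrow>\<^sub>0 nat)" where
  "vertex_mon n m a i j = single i (vertex_exp n m a i j) + single j 1"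

text \<open>A proper divisor is either a pure power of the \<open>i\<close>-th variable, or still
  contains the \<open>j\<close>-th one with a smaller power of the \<open>i\<close>-th; the latter
  is isolated by minimality of \<open>vertex_exp\<close>.\<close>

lemma critical_vertex_mon:
  assumes sd: "simplicial_data n m d a" and i: "i < m" and j: "j \<in> conormal_indices n m a i"
  shows "critical n m a (vertex_mon n m a i j)"
  unfolding critical_def
proof (intro conjI allI impI)
  let ?k = "vertex_exp n m a i j"
  have in_n: "i < n" using sd i by (auto simp: simplicial_data_def)
  have jn: "j < n" "j \<noteq> i" using j by (auto simp: conormal_indices_def)
  show "keys (vertex_mon n m a i j) \<subseteq> {..<n}"
    using in_n jn by (auto simp: vertex_mon_def keys_plus_nat split: if_splits)
  have ex: "\<exists>k. \<not> isolated n m a (single i k + single j 1)"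
    using j by (simp add: conormal_indices_def)
  show "\<not> isolated n m a (vertex_mon n m a i j)"
    unfolding vertex_mon_def vertex_exp_def using ex by (rule LeastI_ex)
  fix s v assume sv: "vertex_mon n m a i j = s + v" and "s \<noteq> 0"
  have look: "lookup s l + lookup v l = (if l = i then ?k else if l = j then 1 else 0)" for l
    using arg_cong[OF sv, of "\<lambda>w. lookup w l"] jn
    by (auto simp: vertex_mon_def lookup_add lookup_single when_def split: if_splits)
  consider "lookup v j = 0" | "lookup v j = 1" using look[of j] jn by force
  then show "isolated n m a v"
  proof cases
    case 1
    then have "lookup v l = lookup (single i (lookup v i)) l" for l
      using look[of l] by (auto simp: lookup_single when_def split: if_splits)
    then have "v = single i (lookup v i)" by (intro poly_mapping_eqI)
    then show ?thesis using isolated_vertex_power[OF sd i] by metis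
  next
    case 2
    have "lookup v l = lookup (single i (lookup v i) + single j 1) l" for l
      using look[of l] jn 2 by (auto simp: lookup_add lookup_single when_def split: if_splits)
    then have v: "v = single i (lookup v i) + single j 1" by (intro poly_mapping_eqI)
    \<comment> \<open>The factor \<open>j\<close> already lies in \<open>v\<close>, so a nontrivial
      cofactor \<open>s\<close> must take away a power of the \<open>i\<close>-th variable.\<close>
    have "lookup s i \<noteq> 0"
    proof
      assume "lookup s i = 0"
      then have "lookup s l = 0" for l using look[of l] look[of j] jn 2 by (auto split: if_splits)
      then show False using \<open>s \<noteq> 0\<close> by (auto intro: poly_mapping_eqI)
    qed
    then have "lookup v i < ?k" using look[of i] by simp
    then have "isolated n m a (single i (lookup v i) + single j 1)"
      unfolding vertex_exp_def using not_less_Least by blast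
    then show ?thesis using v by metis
  qed
qed

lemma mon_image_vertex_mon:
  assumes "i < n" "j < n"
  shows "mon_image n m a (vertex_mon n m a i j)
       = (\<lambda>l. if l < m then vertex_exp n m a i j * a i l + a j l else 0)"
  using assms by (auto simp: vertex_mon_def mon_image_plus mon_image_single fun_eq_iff)

lemma sum_mon_image_vertex_mon:
  assumes sd: "simplicial_data n m d a" and "i < n" "j < n"
  shows "(\<Sum>l<m. mon_image n m a (vertex_mon n m a i j) l) = (vertex_exp n m a i j + 1) * d"
proof -
  have "(\<Sum>l<m. mon_image n m a (vertex_mon n m a i j) l)
      = vertex_exp n m a i j * (\<Sum>l<m. a i l) + (\<Sum>l<m. a j l)"
    using assms by (simp add: mon_image_vertex_mon sum.distrib sum_distrib_left)
  then show ?thesis using assms by (simp add: simplicial_sum)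
qed

text \<open>The coordinate sum of the degree is \<open>(k + 1) * d\<close>, which determines the
  exponent \<open>k\<close>.\<close>

lemma vertex_exp_eqI:
  assumes sd: "simplicial_data n m d a" and "i < n" "j < n" "i' < n" "j' < n"
    and "mon_image n m a (vertex_mon n m a i j) = mon_image n m a (vertex_mon n m a i' j')"
  shows "vertex_exp n m a i j = vertex_exp n m a i' j'"
proof -
  have "(vertex_exp n m a i j + 1) * d = (vertex_exp n m a i' j' + 1) * d"
    using assms sum_mon_image_vertex_mon[OF sd] by metis
  moreover have "d > 0" using sd by (simp add: simplicial_data_def)
  ultimately show ?thesis by simp
qed

text \<open>Equal degrees force equal exponents of the \<open>i\<close>-th variable; cancelling that
  power leaves \<open>a j = a j'\<close>.\<close>

lemma inj_on_mon_image_vertex_mon: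
  assumes sd: "simplicial_data n m d a" and i: "i < m"
  shows "inj_on (\<lambda>j. mon_image n m a (vertex_mon n m a i j)) (conormal_indices n m a i)"
proof (rule inj_onI)
  fix j j'
  assume "j \<in> conormal_indices n m a i" "j' \<in> conormal_indices n m a i"
  then have jn: "j < n" "j' < n" by (auto simp: conormal_indices_def)
  have "i < n" using sd i by (auto simp: simplicial_data_def)
  assume eq: "mon_image n m a (vertex_mon n m a i j) = mon_image n m a (vertex_mon n m a i j')"
  have k: "vertex_exp n m a i j = vertex_exp n m a i j'"
    by (rule vertex_exp_eqI[OF sd \<open>i < n\<close> jn(1) \<open>i < n\<close> jn(2) eq])
  have "a j l = a j' l" if "l < m" for l
    using fun_cong[OF eq, of l] that jn \<open>i < n\<close> k by (simp add: mon_image_vertex_mon)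
  then show "j = j'" using simplicial_inj[OF sd jn] by blast
qed

text \<open>Exponent zero would make a single variable non-isolated. A monomial of the same degree
  is again a single variable, and distinct variables have distinct degrees.\<close>

lemma vertex_exp_pos:
  assumes sd: "simplicial_data n m d a" and i: "i < m" and j: "j \<in> conormal_indices n m a i"
  shows "vertex_exp n m a i j > 0"
proof (rule ccontr)
  assume "\<not> ?thesis"
  then have k: "vertex_exp n m a i j = 0" by simp
  have jn: "j < n" using j by (auto simp: conormal_indices_def)
  have d: "d > 0" using sd by (simp add: simplicial_data_def)
  have "\<not> isolated n m a (single j 1)"
    using critical_vertex_mon[OF assms] k by (simp add: critical_def vertex_mon_def)
  then obtain v where v: "keys v \<subseteq> {..<n}" "v \<noteq> single j 1"
    and img: "mon_image n m a v = mon_image n m a (single j 1)"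
    by (auto simp: isolated_def)
  \<comment> \<open>Comparing coordinate sums shows that \<open>v\<close> has total degree
    one.\<close>
  have "d * (\<Sum>s<n. lookup v s) = d * 1"
    using sum_mon_image[OF sd, of v] img jn simplicial_sum[OF sd jn]
    by (auto simp: mon_image_single)
  then have one: "(\<Sum>s<n. lookup v s) = 1" using d by simp
  then obtain t where t: "t < n" "lookup v t \<noteq> 0"
    by (metis lessThan_iff sum.neutral zero_neq_one)
  then have "lookup v t + (\<Sum>s\<in>{..<n} - {t}. lookup v s) = 1"
    using one by (simp add: sum.remove[of _ t])
  then have "lookup v t = 1" and "(\<Sum>s\<in>{..<n} - {t}. lookup v s) = 0"
    using t by linarith+
  then have "lookup v t = 1" "\<And>s. s < n \<Longrightarrow> s \<noteq> t \<Longrightarrow> lookup v s = 0"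
    by simp_all
  moreover have "lookup v s = 0" if "\<not> s < n" for s
    using v(1) that by (auto simp: in_keys_iff)
  ultimately have "lookup v s = lookup (single t 1) s" for s
    by (cases "s < n") (auto simp: lookup_single when_def t)
  then have vt: "v = single t 1" by (intro poly_mapping_eqI)
  have "a t l = a j l" if "l < m" for l
    using fun_cong[OF img, of l] that t jn by (simp add: vt mon_image_single)
  then have "t = j" using simplicial_inj[OF sd t(1) jn] by blast
  then show False using v(2) vt by simp
qed

section \<open>Smooth complete intersections\<close>

text \<open>Vertex \<open>i\<close> already supplies at least \<open>n - m\<close> critical
  monomials with distinct degrees. A further degree coming from vertex \<open>i'\<close> would
  require more than \<open>n - m\<close> generators.\<close>

lemma complete_intersection_degrees:
  fixes G :: "'k::field mpoly set"
  assumes sd: "simplicial_data n m d a"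
    and smooth: "smooth_proj n (n - m) (toric_ideal n m a :: 'k mpoly set)"
    and G: "finite G" "card G = n - m" "gen_ideal n G = toric_ideal n m a"
    and i: "i < m" "i' < m" and j': "j' \<in> conormal_indices n m a i'"
  shows "\<exists>j\<in>conormal_indices n m a i.
           mon_image n m a (vertex_mon n m a i j) = mon_image n m a (vertex_mon n m a i' j')"
proof (rule ccontr)
  let ?J = "conormal_indices n m a i"
  let ?w = "vertex_mon n m a i" and ?w' = "vertex_mon n m a i' j'"
  let ?W = "insert ?w' (?w ` ?J)"
  assume "\<not> ?thesis"
  then have new: "mon_image n m a ?w' \<notin> mon_image n m a ` ?w ` ?J" by auto
  have inj: "inj_on (mon_image n m a \<circ> ?w) ?J"
    using inj_on_mon_image_vertex_mon[OF sd i(1)] by (simp add: comp_def)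
  have "card ?W = Suc (card ?J)"
    using new inj finite_conormal_indices[of n m a i]
    by (subst card_insert_disjoint) (auto simp: card_image inj_on_imageI2)
  moreover have "card ?W \<le> card G"
  proof (rule card_critical_le_generators[OF G(1,3)])
    show "finite ?W" using finite_conormal_indices[of n m a i] by simp
    show "critical n m a w" if "w \<in> ?W" for w
      using that critical_vertex_mon[OF sd i(1)] critical_vertex_mon[OF sd i(2) j'] by auto
    show "inj_on (mon_image n m a) ?W"
      using new inj_on_imageI[OF inj] by auto
  qed
  ultimately show False
    using card_conormal_indices_ge[OF sd i(1) smooth] G(2) by simp
qed

lemma smooth_complete_intersection_imp_conic:
  fixes G :: "'k::field mpoly set"
  assumes sd: "simplicial_data n m d a"
    and smooth: "smooth_proj n (n - m) (toric_ideal n m a :: 'k mpoly set)"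
    and G: "finite G" "card G = n - m" "gen_ideal n G = toric_ideal n m a"
  shows "n = 3 \<and> m = 2 \<and> d = 2 * a 2 0 \<and> d = 2 * a 2 1"
proof -
  have mn: "m < n" and d: "d > 0" and m2: "2 \<le> m"
    and al: "\<And>l j. l < m \<Longrightarrow> j < m \<Longrightarrow> a l j = (if j = l then d else 0)"
    using sd simplicial_m_ge_2[OF sd] by (auto simp: simplicial_data_def)
  let ?J = "conormal_indices n m a 0"
  let ?\<beta> = "\<lambda>j. mon_image n m a (vertex_mon n m a 0 j)"
  have cardJ: "n - m \<le> card ?J"
    using card_conormal_indices_ge[OF sd _ smooth] m2 by simp
  have main: "m = 2 \<and> j = 1 \<and> vertex_exp n m a 0 j = 1" if j: "j \<in> ?J" for j
  proof -
    let ?k = "vertex_exp n m a 0 j"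
    have jn: "j < n" using j by (simp add: conormal_indices_def)
    have k: "?k > 0" using vertex_exp_pos[OF sd _ j] m2 by simp
    \<comment> \<open>The same degree also arises at vertex \<open>i\<close>, with the same exponent
      \<open>?k\<close>; there the power of the \<open>i\<close>-th variable alone contributes
      \<open>?k * d\<close> to coordinate \<open>i\<close>.\<close>
    have ge: "?k * d \<le> ?\<beta> j i" if i: "i < m" for i
    proof -
      obtain j' where j': "j' \<in> conormal_indices n m a i"
        and eq: "mon_image n m a (vertex_mon n m a i j') = ?\<beta> j"
        using complete_intersection_degrees[OF sd smooth G i _ j] m2 by auto
      have j'n: "j' < n" using j' by (simp add: conormal_indices_def)
      have "vertex_exp n m a i j' = ?k"
        using vertex_exp_eqI[OF sd _ j'n _ jn eq] i mn m2 by simp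
      then show ?thesis
        using i mn j'n al by (simp add: eq[symmetric] mon_image_vertex_mon)
    qed
    have total: "(\<Sum>i<m. ?\<beta> j i) = (?k + 1) * d"
      using sum_mon_image_vertex_mon[OF sd _ jn] mn by simp
    have "(\<Sum>i<m. ?k * d) \<le> (\<Sum>i<m. ?\<beta> j i)"
      using ge by (intro sum_mono) auto
    then have "m * ?k * d \<le> (?k + 1) * d" using total by (simp add: mult.assoc)
    then have mk: "m * ?k \<le> ?k + 1" using d by (rule mult_right_le_imp_le)
    have "2 * ?k \<le> m * ?k" using m2 by simp
    then have k1: "?k = 1" using mk k by linarith
    then have m: "m = 2" using mk m2 by simp
    \<comment> \<open>Both coordinates are at least \<open>d\<close> and sum to
      \<open>2 * d\<close>, so the degree is \<open>(d, d)\<close>. Removing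
      \<open>a 0 = (d, 0)\<close> leaves \<open>a j = (0, d) = a 1\<close>.\<close>
    have "?\<beta> j 0 + ?\<beta> j 1 = 2 * d" using total k1 m by (simp add: numeral_2_eq_2)
    moreover have "d \<le> ?\<beta> j 0" "d \<le> ?\<beta> j 1" using ge[of 0] ge[of 1] k1 m by auto
    ultimately have "?\<beta> j 0 = d" "?\<beta> j 1 = d" by auto
    then have aj: "a j 0 = 0" "a j 1 = d"
      using jn mn m k1 al[of 0 0] al[of 0 1] by (auto simp: mon_image_vertex_mon)
    have "j = 1"
    proof (rule simplicial_inj[OF sd jn])
      show "1 < n" using mn m by simp
      show "a j l = a 1 l" if "l < m" for l
        using that m aj al[of 1 0] al[of 1 1] by (auto simp: less_2_cases_iff)
    qed
    then show ?thesis using m k1 by simp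
  qed
  have "?J \<noteq> {}" using cardJ mn by auto
  then obtain j0 where j0: "j0 \<in> ?J" by blast
  from main[OF j0] j0 have m: "m = 2" and one: "1 \<in> ?J" and k1: "vertex_exp n m a 0 1 = 1"
    by auto
  have "?J \<subseteq> {1}" using main by auto
  then have "card ?J \<le> 1" using card_mono[of "{1}" ?J] by simp
  then have n: "n = 3" using cardJ mn m by simp
  let ?w = "single 0 1 + single 1 1 :: nat \<Rightarrow>\<^sub>0 nat"
  \<comment> \<open>A second monomial \<open>v\<close> in the fibre of \<open>?w\<close> now has to
    be located; its exponents \<open>?x\<close>, \<open>?y\<close>, \<open>?z\<close> are pinned
    down by the two coordinate equations.\<close>
  have "\<not> isolated n m a ?w"
    using critical_vertex_mon[OF sd _ one] m k1 by (simp add: critical_def vertex_mon_def)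
  then obtain v where v: "keys v \<subseteq> {..<n}" "v \<noteq> ?w" and img: "mon_image n m a v = mon_image n m a ?w"
    by (auto simp: isolated_def)
  have a01: "a 0 0 = d" "a 0 1 = 0" "a 1 0 = 0" "a 1 1 = d"
    using al m by auto
  have a2: "a 2 0 + a 2 1 = d"
    using simplicial_sum[OF sd, of 2] n m by (simp add: numeral_2_eq_2)
  have img0: "mon_image n m a v l = d" if "l < 2" for l
    unfolding img using that a01
    by (auto simp: mon_image_plus mon_image_single n m less_2_cases_iff)
  let ?x = "lookup v 0" and ?y = "lookup v 1" and ?z = "lookup v 2"
  have e0: "?x * d + ?z * a 2 0 = d" and e1: "?y * d + ?z * a 2 1 = d"
    using img0[of 0] img0[of 1] a01 by (simp_all add: mon_image_def n m eval_nat_numeral)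
  have v2: "v = ?w" if "?x = 1" "?y = 1" "?z = 0"
  proof (rule poly_mapping_eqI)
    fix s
    have "lookup v s = 0" if "3 \<le> s" using v(1) that by (auto simp: in_keys_iff n)
    moreover have "s = 0 \<or> s = 1 \<or> s = 2 \<or> 3 \<le> s" by linarith
    ultimately show "lookup v s = lookup ?w s"
      using that by (auto simp: lookup_add lookup_single)
  qed
  \<comment> \<open>A zero coordinate would turn \<open>a 2\<close> into \<open>a 0\<close> or
    \<open>a 1\<close>.\<close>
  have pos: "a 2 0 > 0" "a 2 1 > 0"
  proof -
    have "\<exists>l<m. a 2 l \<noteq> a 1 l" "\<exists>l<m. a 2 l \<noteq> a 0 l"
      using simplicial_inj[OF sd, of 2 1] simplicial_inj[OF sd, of 2 0] n by auto
    then show "a 2 0 > 0" "a 2 1 > 0" using a2 a01 m by (auto simp: less_2_cases_iff)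
  qed
  have "?x * d + ?y * d + ?z * (a 2 0 + a 2 1) = 2 * d"
    using e0 e1 by (simp add: algebra_simps)
  then have "(?x + ?y + ?z) * d = 2 * d" unfolding a2 by (simp add: algebra_simps)
  then have sum2: "?x + ?y + ?z = 2" using d by simp
  have "?x \<noteq> 1 \<or> ?y \<noteq> 1" using v(2) v2 sum2 by auto
  moreover have "?x \<le> 1"
  proof (rule ccontr)
    assume "\<not> ?x \<le> 1"
    then have "2 * d \<le> ?x * d" by (intro mult_right_mono) auto
    then show False using e0 d by linarith
  qed
  moreover have "?y \<le> 1"
  proof (rule ccontr)
    assume "\<not> ?y \<le> 1"
    then have "2 * d \<le> ?y * d" by (intro mult_right_mono) auto
    then show False using e1 d by linarith
  qed
  \<comment> \<open>If \<open>?z = 1\<close>, then \<open>?x\<close> or \<open>?y\<close> is 1, and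
    the corresponding coordinate exceeds \<open>d\<close>.\<close>
  moreover have "?z \<noteq> 1"
  proof
    assume z: "?z = 1"
    then have "?x = 1 \<or> ?y = 1" using sum2 by linarith
    then show False using e0 e1 z pos by auto
  qed
  \<comment> \<open>The case \<open>?z = 0\<close> would need \<open>?x = ?y = 1\<close>, which is
    \<open>?w\<close> itself.\<close>
  ultimately have "?z = 2" using sum2 by linarith
  then have "d = 2 * a 2 0" "d = 2 * a 2 1" using e0 e1 sum2 by auto
  then show ?thesis using n m by simp
qed

text \<open>Each exponent vector is \<open>a 2 0\<close>, that is \<open>d/2\<close>, times the one
  of the conic, and scaling by a positive integer does not change the fibres.\<close>

lemma toric_ideal_conic:
  assumes "simplicial_data 3 2 d a" "d = 2 * a 2 0" "d = 2 * a 2 1"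
  shows "toric_ideal 3 2 a = toric_ideal 3 2 curve_exps"
proof (rule toric_ideal_cong)
  have al: "\<And>l j. l < 2 \<Longrightarrow> j < 2 \<Longrightarrow> a l j = (if j = l then d else 0)" and d: "d > 0"
    using assms(1) by (auto simp: simplicial_data_def)
  have p: "a 2 0 > 0" using d assms by simp
  have scale: "a i l = a 2 0 * curve_exps i l" if "i < 3" "l < 2" for i l
  proof -
    consider "i < 2" | "i = 2" using \<open>i < 3\<close> by linarith
    then show ?thesis
    proof cases
      case 1
      then show ?thesis using al[OF 1 \<open>l < 2\<close>] assms(2) \<open>l < 2\<close>
        by (auto simp: curve_exps_def less_2_cases_iff)
    next
      case 2
      have "a 2 1 = a 2 0" using assms(2,3) by linarith
      then show ?thesis using 2 \<open>l < 2\<close> by (auto simp: curve_exps_def less_2_cases_iff)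
    qed
  qed
  have "mon_image 3 2 a u = (\<lambda>l. a 2 0 * mon_image 3 2 curve_exps u l)" for u
  proof
    fix l
    have "(\<Sum>i<3. lookup u i * a i l) = (\<Sum>i<3. a 2 0 * (lookup u i * curve_exps i l))" if "l < 2"
    proof (intro sum.cong refl)
      fix i :: nat assume "i \<in> {..<3}"
      then show "lookup u i * a i l = a 2 0 * (lookup u i * curve_exps i l)"
        by (subst scale) (auto simp: that)
    qed
    then show "mon_image 3 2 a u l = a 2 0 * mon_image 3 2 curve_exps u l"
      by (simp add: mon_image_def sum_distrib_left)
  qed
  then show "mon_image 3 2 a u = mon_image 3 2 a v
         \<longleftrightarrow> mon_image 3 2 curve_exps u = mon_image 3 2 curve_exps v" for u v
    using p by (simp add: fun_eq_iff)
qed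

section \<open>Principality in three variables\<close>

lemma polys_induct [consumes 1, case_names zero add single]:
  assumes "f \<in> polys n" "P 0" "\<And>f g. P f \<Longrightarrow> P g \<Longrightarrow> P (f + g)"
    and "\<And>u r. keys u \<subseteq> {..<n} \<Longrightarrow> P (single u r)"
  shows "P f"
proof -
  have "P (\<Sum>u\<in>A. single u (lookup f u))" if "A \<subseteq> keys f" for A
    using that assms
    by (induction A rule: infinite_finite_induct) (auto simp: polys_def)
  then show ?thesis by (subst poly_mapping_eq_sum_single) simp
qed

text \<open>Each reduction replaces \<open>D\<close> factors of variable 2 by a monomial in
  variables 0 and 1, so the exponent of variable 2 drops strictly. The leading coefficient is 1,
  hence no division in the coefficient ring occurs.\<close>

lemma division_by_monic_binomial:
  fixes f :: "'k::comm_ring_1 mpoly"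
  assumes f: "f \<in> polys 3" and D: "D > 0"
    and h: "h = single (single 2 D) 1 - single (single 0 P + single 1 Q) 1"
  shows "\<exists>c\<in>polys 3. \<exists>R\<in>polys 3. f = c * h + R \<and> (\<forall>u\<in>keys R. lookup u 2 < D)"
  using f
proof (induction rule: polys_induct)
  case zero
  show ?case by (intro bexI[of _ 0]) (auto simp: polys_zero)
next
  case (add f g)
  then obtain c R c' R' where *: "c \<in> polys 3" "R \<in> polys 3" "f = c * h + R"
      "\<forall>u\<in>keys R. lookup u 2 < D" "c' \<in> polys 3" "R' \<in> polys 3" "g = c' * h + R'"
      "\<forall>u\<in>keys R'. lookup u 2 < D"
    by blast
  have "f + g = (c + c') * h + (R + R')" using * by (simp add: algebra_simps)
  moreover have "\<forall>u\<in>keys (R + R'). lookup u 2 < D"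
    using * Poly_Mapping.keys_add[of R R'] by blast
  ultimately show ?case using * by (intro bexI[of _ "c + c'"] bexI[of _ "R + R'"]) (auto simp: polys_add)
next
  case (single u r)
  then show ?case
  proof (induction "lookup u 2" arbitrary: u rule: less_induct)
    case less
    show ?case
    proof (cases "lookup u 2 < D")
      case True
      then show ?thesis using less.prems
        by (intro bexI[of _ "0 :: 'k mpoly"] bexI[of _ "single u r"]) (simp_all add: polys_zero polys_single)
    next
      case False
      define s where "s = u - single 2 D"
      let ?v = "s + (single 0 P + single 1 Q)"
      have u: "u = s + single 2 D"
        using False by (intro poly_mapping_eqI)
          (auto simp: s_def lookup_add lookup_minus lookup_single when_def)
      have ks: "keys s \<subseteq> {..<3}" using less.prems unfolding u keys_plus_nat by auto
      have kv: "keys ?v \<subseteq> {..<3}" using ks by (auto simp: keys_plus_nat split: if_splits)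
      have "lookup ?v 2 < lookup u 2"
        using D by (simp add: u lookup_add lookup_single)
      from less.hyps[OF this kv] obtain c R where cR: "c \<in> polys 3" "R \<in> polys 3"
          "single ?v r = c * h + R" "\<forall>u\<in>keys R. lookup u 2 < D"
        by blast
      have "single s r * h = single u r - single ?v r"
        by (simp add: h u right_diff_distrib mult_single)
      then have "single u r = (single s r + c) * h + R"
        using cR(3) by (simp add: algebra_simps)
      then show ?thesis using cR ks
        by (intro bexI[of _ "single s r + c"] bexI[of _ R]) (auto simp: polys_add polys_single)
    qed
  qed
qed

lemma mult_binomial_in_toric_ideal:
  fixes c :: "'k::comm_ring_1 mpoly"
  assumes "c \<in> polys n" "keys u \<subseteq> {..<n}" "keys v \<subseteq> {..<n}"
    and "mon_image n m a u = mon_image n m a v"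
  shows "c * (single u 1 - single v 1) \<in> toric_ideal n m a"
  using assms(1)
proof (induction rule: polys_induct)
  case zero
  show ?case by (simp add: toric_ideal_zero)
next
  case (add f g)
  then show ?case by (simp add: distrib_right toric_ideal_add)
next
  case (single w r)
  have "single (w + u) r - single (w + v) r \<in> toric_ideal n m a"
    using single assms by (intro toric_ideal_binomial) (auto simp: keys_plus_nat mon_image_plus)
  then show ?case by (simp add: right_diff_distrib mult_single)
qed

text \<open>The generator encodes the primitive relation \<open>D * a 2 = P * a 0 + Q * a 1\<close>,
  obtained by dividing out \<open>gcd d (a 2 0)\<close>. Division leaves a remainder whose monomials
  have pairwise distinct degrees, so a remainder in the ideal is zero.\<close>

lemma min_gen_by_1_toric_curve:
  assumes sd: "simplicial_data 3 2 d a"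
  shows "min_gen_by 3 1 (toric_ideal 3 2 a :: 'k::field mpoly set)"
proof -
  have d: "d > 0" and al: "\<And>l j. l < 2 \<Longrightarrow> j < 2 \<Longrightarrow> a l j = (if j = l then d else 0)"
    using sd by (auto simp: simplicial_data_def)
  have a2: "a 2 0 + a 2 1 = d"
    using simplicial_sum[OF sd, of 2] by (simp add: numeral_2_eq_2)
  define g where "g = gcd d (a 2 0)"
  define D P Q where "D = d div g" and "P = a 2 0 div g" and "Q = a 2 1 div g"
  have g: "g > 0" using d by (simp add: g_def)
  have dg: "g dvd d" "g dvd a 2 0" by (auto simp: g_def)
  then have "g dvd a 2 1" using a2 by (metis dvd_add_right_iff)
  with dg have eqs: "d = D * g" "a 2 0 = P * g" "a 2 1 = Q * g"
    by (auto simp: D_def P_def Q_def)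
  have D: "D > 0" using d eqs by (cases D) auto
  have cop: "coprime D P"
    unfolding D_def P_def g_def using d by (intro div_gcd_coprime) auto
  have img: "mon_image 3 2 a u = (\<lambda>l. if l = 0 then (lookup u 0 * D + lookup u 2 * P) * g
      else if l = 1 then (lookup u 1 * D + lookup u 2 * Q) * g else 0)" for u
  proof
    fix l
    have "(\<Sum>i<3. lookup u i * a i l) = lookup u 0 * a 0 l + lookup u 1 * a 1 l + lookup u 2 * a 2 l"
      by (simp add: eval_nat_numeral)
    moreover have "l = 0 \<or> l = 1 \<or> l \<ge> 2" by linarith
    moreover have "a 0 0 = D * g" "a 1 0 = 0" "a 0 1 = 0" "a 1 1 = D * g"
      using al eqs(1) by simp_all
    ultimately show "mon_image 3 2 a u l = (if l = 0 then (lookup u 0 * D + lookup u 2 * P) * g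
      else if l = 1 then (lookup u 1 * D + lookup u 2 * Q) * g else 0)"
      using eqs(2,3) by (auto simp: mon_image_def distrib_right mult.assoc)
  qed
  let ?u = "single 2 D :: nat \<Rightarrow>\<^sub>0 nat" and ?v = "single 0 P + single 1 Q :: nat \<Rightarrow>\<^sub>0 nat"
  define h :: "'k mpoly" where "h = single ?u 1 - single ?v 1"
  have kuv: "keys ?u \<subseteq> {..<3}" "keys ?v \<subseteq> {..<3}"
    by (auto simp: keys_plus_nat split: if_splits)
  have imguv: "mon_image 3 2 a ?u = mon_image 3 2 a ?v"
    by (auto simp: img fun_eq_iff lookup_add lookup_single)
  have mult: "c * h \<in> toric_ideal 3 2 a" if "c \<in> polys 3" for c
    unfolding h_def by (rule mult_binomial_in_toric_ideal[OF that kuv imguv])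
  have unique: "u = v" if uv: "keys u \<subseteq> {..<3}" "keys v \<subseteq> {..<3}" "lookup u 2 < D" "lookup v 2 < D"
    "mon_image 3 2 a u = mon_image 3 2 a v" for u v
  proof -
    have e0: "lookup u 0 * D + lookup u 2 * P = lookup v 0 * D + lookup v 2 * P"
      using fun_cong[OF uv(5), of 0] g by (simp add: img)
    have e1: "lookup u 1 * D + lookup u 2 * Q = lookup v 1 * D + lookup v 2 * Q"
      using fun_cong[OF uv(5), of 1] g by (simp add: img)
    \<comment> \<open>Modulo \<open>D\<close>, coordinate 0 determines the exponent of variable 2,
      because \<open>P\<close> is coprime to \<open>D\<close>; both exponents are below
      \<open>D\<close>, hence equal. The integers permit the subtraction.\<close>
    have "int (lookup u 0) * int D + int (lookup u 2) * int P
        = int (lookup v 0) * int D + int (lookup v 2) * int P"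
      using e0 by (metis of_nat_add of_nat_mult)
    then have "(int (lookup u 2) - int (lookup v 2)) * int P
        = int D * (int (lookup v 0) - int (lookup u 0))"
      by (simp add: algebra_simps)
    then have "int D dvd (int (lookup u 2) - int (lookup v 2)) * int P" by simp
    then have "int D dvd int (lookup u 2) - int (lookup v 2)"
      using cop by (simp add: coprime_dvd_mult_left_iff)
    then have "int (lookup u 2) - int (lookup v 2) = 0"
      using uv(3,4) dvd_imp_le_int[of "int (lookup u 2) - int (lookup v 2)" "int D"] by force
    then have z2: "lookup u 2 = lookup v 2" by simp
    then have z01: "lookup u 0 = lookup v 0" "lookup u 1 = lookup v 1" using e0 e1 D by auto
    show "u = v"
    proof (rule poly_mapping_eqI)
      fix s
      have "lookup u s = 0" "lookup v s = 0" if "3 \<le> s" using uv that by (auto simp: in_keys_iff)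
      moreover have "s = 0 \<or> s = 1 \<or> s = 2 \<or> 3 \<le> s" by linarith
      ultimately show "lookup u s = lookup v s" using z2 z01 by auto
    qed
  qed
  have "\<exists>c\<in>polys 3. f = c * h" if f: "f \<in> toric_ideal 3 2 a" for f
  proof -
    have "f \<in> polys 3" using f by (simp add: toric_ideal_def)
    from division_by_monic_binomial[OF this D h_def] obtain c R where cR: "c \<in> polys 3"
        "R \<in> polys 3" "f = c * h + R" "\<forall>u\<in>keys R. lookup u 2 < D"
      by blast
    have "R = f - c * h" using cR by simp
    then have RI: "R \<in> toric_ideal 3 2 a" using f mult[OF cR(1)] by (simp add: toric_ideal_diff)
    have "keys R = {}"
    proof (rule ccontr)
      assume "keys R \<noteq> {}"
      then obtain w where w: "w \<in> keys R" by blast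
      \<comment> \<open>The fibre condition at the degree of \<open>w\<close> reduces to the
        vanishing of the single coefficient at \<open>w\<close>.\<close>
      have "{u \<in> keys R. mon_image 3 2 a u = mon_image 3 2 a w} = {w}"
        using w cR(2,4) unique[of _ w] by (auto simp: polys_def)
      moreover have "(\<Sum>u\<in>{u \<in> keys R. mon_image 3 2 a u = mon_image 3 2 a w}. lookup R u) = 0"
        using RI by (simp add: toric_ideal_def)
      ultimately show False using w by (simp add: in_keys_iff)
    qed
    then have "R = 0" by simp
    then show ?thesis using cR by auto
  qed
  then have "gen_ideal 3 {h} = toric_ideal 3 2 a"
    using mult by (fastforce simp: gen_ideal_def)
  moreover have "h \<in> polys 3" unfolding h_def using kuv by (intro polys_diff polys_single)
  \<comment> \<open>Fewer than one generator means none, which would give the zero ideal; but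
    \<open>h\<close> is a nonzero element.\<close>
  moreover have "gen_ideal 3 {} \<noteq> (toric_ideal 3 2 a :: 'k mpoly set)"
  proof
    assume "gen_ideal 3 {} = (toric_ideal 3 2 a :: 'k mpoly set)"
    moreover have "h \<in> toric_ideal 3 2 a"
      unfolding h_def by (rule toric_ideal_binomial[OF kuv imguv])
    ultimately have "h = 0" by (auto simp: gen_ideal_def)
    moreover have "?v \<noteq> ?u"
    proof
      assume "?v = ?u"
      then have "lookup ?v 2 = lookup ?u 2" by simp
      then show False using D by (simp add: lookup_add lookup_single)
    qed
    then have "lookup h ?u = 1" by (simp add: h_def lookup_minus lookup_single when_def)
    ultimately show False by simp
  qed
  ultimately show ?thesis
    unfolding min_gen_by_def by (intro conjI exI[of _ "{h}"]) auto
qed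

theorem mainTheorem13:
  fixes n m d :: nat and a :: "nat \<Rightarrow> nat \<Rightarrow> nat"
  assumes "alg_closed_field TYPE('k::field)"
    and "simplicial_data n m d a"
    and "smooth_proj n (n - m) (toric_ideal n m a :: 'k mpoly set)"
  shows "min_gen_by n (n - m) (toric_ideal n m a :: 'k mpoly set) \<longleftrightarrow>
         (n = 3 \<and> (\<exists>\<sigma>. \<sigma> permutes {..<3} \<and>
            cone n (toric_ideal n m a :: 'k mpoly set)
              = (\<lambda>x. x \<circ> \<sigma>) ` cone 3 (toric_ideal 3 2 curve_exps :: 'k mpoly set)))"
proof
  assume "min_gen_by n (n - m) (toric_ideal n m a :: 'k mpoly set)"
  then obtain G :: "'k mpoly set" where
    "finite G" "card G = n - m" "gen_ideal n G = toric_ideal n m a"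
    by (auto simp: min_gen_by_def)
  from smooth_complete_intersection_imp_conic[OF assms(2,3) this]
  have nm: "n = 3" "m = 2" and "d = 2 * a 2 0" "d = 2 * a 2 1" by auto
  then have "toric_ideal n m a = (toric_ideal 3 2 curve_exps :: 'k mpoly set)"
    using toric_ideal_conic assms(2) by simp
  \<comment> \<open>The ideals coincide without renaming coordinates, so the permutation is the
    identity.\<close>
  then have "cone n (toric_ideal n m a)
      = (\<lambda>x. x \<circ> id) ` cone 3 (toric_ideal 3 2 curve_exps :: 'k mpoly set)"
    using nm by simp
  then show "n = 3 \<and> (\<exists>\<sigma>. \<sigma> permutes {..<3} \<and>
            cone n (toric_ideal n m a :: 'k mpoly set)
              = (\<lambda>x. x \<circ> \<sigma>) ` cone 3 (toric_ideal 3 2 curve_exps :: 'k mpoly set))"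
    using nm(1) permutes_id[of "{..<3::nat}"] by blast
next
  assume "n = 3 \<and> (\<exists>\<sigma>. \<sigma> permutes {..<3} \<and>
            cone n (toric_ideal n m a :: 'k mpoly set)
              = (\<lambda>x. x \<circ> \<sigma>) ` cone 3 (toric_ideal 3 2 curve_exps :: 'k mpoly set))"
  then have n: "n = 3" by simp
  \<comment> \<open>With \<open>n = 3\<close>, the bounds on \<open>m\<close> leave only
    \<open>m = 2\<close>, the case of a principal ideal.\<close>
  have "m < n" using assms(2) by (simp add: simplicial_data_def)
  then have "m = 2" using simplicial_m_ge_2[OF assms(2)] n by simp
  then show "min_gen_by n (n - m) (toric_ideal n m a :: 'k mpoly set)"
    using min_gen_by_1_toric_curve assms(2) n by simp
qed

end
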